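(* For all integers $m,n\geq 0$, the lattice $\mathbf{W}(m,n)$ is extremal.
   Context: An $(m,n)$-word is a word $\mathfrak{w}=w_1w_2\cdots w_n$ of length $n$ over the alphabet $\{0,1,\dots,m+1\}$ such that (MN1) $w_1\neq m+1$, and (MN2) for every $s$ with $1\le s\le m$ and every index $i$, if $w_i=s$ then $w_j\ge s$ for all $j<i$. $\mathbf{W}(m,n)$ is the set of $(m,n)$-words ordered componentwise ($\mathfrak{u}\le\mathfrak{v}$ iff $u_i\le v_i$ for all $i$); this is a lattice. An element $j$ of a finite lattice is join-irreducible if $j=p\vee q$ implies $p=j$ or $q=j$ (the bottom element is not join-irreducible); meet-irreducible is defined dually. The length $\ell(\mathbf{P})$ of a finite lattice $\mathbf{P}$ is one less than the maximum cardinality of a chain. $\mathbf{P}$ is extremal if the number of join-irreducible elements, $\ell(\mathbf{P})$, and the number of meet-irreducible elements coincide. *)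

theory Defs
  imports "HOL-Algebra.Lattice"
begin

section \<open>Extremal lattices\<close>

definition join_irreducible :: "('a, 'b) gorder_scheme \<Rightarrow> 'a \<Rightarrow> bool" where
  "join_irreducible L j \<longleftrightarrow>
     j \<in> carrier L \<and> j \<noteq> \<bottom>\<^bsub>L\<^esub> \<and>
     (\<forall>p\<in>carrier L. \<forall>q\<in>carrier L. j = p \<squnion>\<^bsub>L\<^esub> q \<longrightarrow> p = j \<or> q = j)"

definition meet_irreducible :: "('a, 'b) gorder_scheme \<Rightarrow> 'a \<Rightarrow> bool" where
  "meet_irreducible L j \<longleftrightarrow>
     j \<in> carrier L \<and> j \<noteq> \<top>\<^bsub>L\<^esub> \<and>
     (\<forall>p\<in>carrier L. \<forall>q\<in>carrier L. j = p \<sqinter>\<^bsub>L\<^esub> q \<longrightarrow> p = j \<or> q = j)"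

text \<open>Only meaningful for a finite nonempty carrier: then the maximum is that of a finite
  set of numbers and is positive, so the subtraction does not truncate.\<close>

definition lattice_length :: "('a, 'b) gorder_scheme \<Rightarrow> nat" where
  "lattice_length L =
     Max {card C | C. C \<subseteq> carrier L \<and> Complete_Partial_Order.chain (\<sqsubseteq>\<^bsub>L\<^esub>) C} - 1"

text \<open>The locale \<^locale>\<open>Lattice.lattice\<close> admits an empty carrier, which is excluded here.\<close>

definition extremal :: "('a, 'b) gorder_scheme \<Rightarrow> bool" where
  "extremal L \<longleftrightarrow>
     Lattice.lattice L \<and> finite (carrier L) \<and> carrier L \<noteq> {} \<and>
     card {j. join_irreducible L j} = lattice_length L \<and>
     lattice_length L = card {j. meet_irreducible L j}"


section \<open>The lattice of \<open>(m,n)\<close>-words\<close>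

text \<open>Words are lists, so the letter with index \<open>i\<close> (counted from 1) is \<open>w ! (i - 1)\<close>.\<close>

definition mn_word :: "nat \<Rightarrow> nat \<Rightarrow> nat list \<Rightarrow> bool" where
  "mn_word m n w \<longleftrightarrow>
     length w = n \<and> set w \<subseteq> {0..m + 1} \<and>
     (0 < n \<longrightarrow> w ! 0 \<noteq> m + 1) \<and>
     (\<forall>s i. 1 \<le> s \<and> s \<le> m \<and> i < n \<and> w ! i = s \<longrightarrow> (\<forall>j<i. s \<le> w ! j))"

definition mn_words :: "nat \<Rightarrow> nat \<Rightarrow> nat list gorder" where
  "mn_words m n = \<lparr>carrier = {w. mn_word m n w}, eq = (=), le = list_all2 (\<le>)\<rparr>"

end

theory Submission
  imports Defs
begin

text \<open>In a finite lattice every chain has at most one element more than there are join-irreducible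
  elements, and every join-dense set contains all join-irreducible elements; dually for meets. So a
  chain with \<open>k + 1\<close> elements, a join-dense set and a meet-dense set, each with at most \<open>k\<close>
  elements, force the lattice to be extremal. The letters of a word have maxima \<open>m, m + 1, \<dots>, m + 1\<close>.
  With \<open>k\<close> the sum of these maxima, the words that are least (greatest) with a prescribed nonzero
  (nonmaximal) letter at a prescribed place form such a dense set, and raising the letters one step
  at a time, from left to right in each round, gives the chain.\<close>

section \<open>A criterion for extremality\<close>

context partial_order
begin

lemma finite_ex_minimal:
  assumes "finite A" and "A \<noteq> {}" and "A \<subseteq> carrier L"
  obtains z where "z \<in> A" and "\<And>x. x \<in> A \<Longrightarrow> x \<sqsubseteq> z \<Longrightarrow> x = z"
proof -
  have "asymp_on A (\<sqsubset>)"
    using assms(3) le_antisym by (metis asymp_onI lless_eq subsetD)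
  moreover have "transp_on A (\<sqsubset>)"
    using assms(3) le_antisym le_trans by (smt (verit) lless_eq subsetD transp_onI)
  ultimately obtain z where "z \<in> A" "\<forall>x\<in>A. x \<noteq> z \<longrightarrow> \<not> x \<sqsubset> z"
    using Finite_Set.bex_min_element[OF assms(1) _ _ assms(2)] by blast
  then show thesis
    using that unfolding lless_eq by blast
qed

lemma finite_ex_maximal:
  assumes "finite A" and "A \<noteq> {}" and "A \<subseteq> carrier L"
  obtains z where "z \<in> A" and "\<And>x. x \<in> A \<Longrightarrow> z \<sqsubseteq> x \<Longrightarrow> x = z"
  using partial_order.finite_ex_minimal[OF dual_order, of A] assms by auto

end

context Lattice.lattice
begin

text \<open>\<open>\<bottom>\<close> is a choice among least elements, so one has to exist. A
  minimal \<open>z\<close> is one: \<open>z \<sqinter> x\<close> lies below \<open>z\<close>, hence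
  equals it.\<close>

lemma finite_bottom_least:
  assumes "finite (carrier L)" and "carrier L \<noteq> {}"
  shows "least L \<bottom> (carrier L)"
proof -
  obtain z where z: "z \<in> carrier L" "\<And>x. x \<in> carrier L \<Longrightarrow> x \<sqsubseteq> z \<Longrightarrow> x = z"
    using finite_ex_minimal[OF assms subset_refl] by blast
  have "z \<sqsubseteq> x" if "x \<in> carrier L" for x
    using z(2)[of "z \<sqinter> x"] z(1) that meet_left meet_right meet_closed by metis
  then have "least L z (carrier L)"
    using z(1) by (auto simp: least_def)
  then show ?thesis
    unfolding bottom_def by (rule someI)
qed

section \<open>Join-irreducible elements: separation, density and chains\<close>

text \<open>A minimal element among those below \<open>x\<close> and not below \<open>y\<close>
  works: were it the join of two strictly smaller elements, both would lie below \<open>y\<close> by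
  minimality, and so would their join.\<close>

lemma ex_join_irreducible_separating:
  assumes fin: "finite (carrier L)" and x: "x \<in> carrier L" and y: "y \<in> carrier L"
    and nle: "\<not> x \<sqsubseteq> y"
  obtains j where "join_irreducible L j" and "j \<sqsubseteq> x" and "\<not> j \<sqsubseteq> y"
proof -
  define Z where "Z = {z \<in> carrier L. z \<sqsubseteq> x \<and> \<not> z \<sqsubseteq> y}"
  have "finite Z" "Z \<noteq> {}" "Z \<subseteq> carrier L"
    using fin x nle by (auto simp: Z_def)
  then obtain z where zZ: "z \<in> Z" and zmin: "\<And>u. u \<in> Z \<Longrightarrow> u \<sqsubseteq> z \<Longrightarrow> u = z"
    using finite_ex_minimal by blast
  have z: "z \<in> carrier L" "z \<sqsubseteq> x" "\<not> z \<sqsubseteq> y"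
    using zZ by (auto simp: Z_def)
  have "z \<noteq> \<bottom>"
    using finite_bottom_least[OF fin] y z(3) by (auto simp: least_def)
  moreover have "p = z \<or> q = z" if p: "p \<in> carrier L" and q: "q \<in> carrier L" and pq: "z = p \<squnion> q" for p q
  proof (rule ccontr)
    assume neq: "\<not> (p = z \<or> q = z)"
    have le: "p \<sqsubseteq> z" "q \<sqsubseteq> z"
      using p q pq join_left join_right by auto
    then have "p \<notin> Z" "q \<notin> Z"
      using neq zmin by blast+
    moreover have "p \<sqsubseteq> x" "q \<sqsubseteq> x"
      using le p q z x le_trans by blast+
    ultimately have "p \<sqsubseteq> y" "q \<sqsubseteq> y"
      using p q by (auto simp: Z_def)
    then have "z \<sqsubseteq> y"
      using pq p q y join_le by simp
    with z(3) show False ..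
  qed
  ultimately have "join_irreducible L z"
    using z(1) by (auto simp: join_irreducible_def)
  then show thesis
    using that z by blast
qed

text \<open>The elements strictly below a join-irreducible \<open>j\<close> have a greatest element
  \<open>u\<close>. Whatever lies below \<open>j\<close> but not below \<open>u\<close> is
  \<open>j\<close> itself, so the member of \<open>D\<close> that separates \<open>j\<close> from
  \<open>u\<close> is \<open>j\<close>.\<close>

lemma join_irreducible_mem_join_dense:
  assumes fin: "finite (carrier L)" and D: "D \<subseteq> carrier L"
    and dense: "\<And>x y. x \<in> carrier L \<Longrightarrow> y \<in> carrier L \<Longrightarrow> \<not> x \<sqsubseteq> y \<Longrightarrow> \<exists>d\<in>D. d \<sqsubseteq> x \<and> \<not> d \<sqsubseteq> y"
    and j: "join_irreducible L j"
  shows "j \<in> D"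
proof -
  have jc: "j \<in> carrier L" and "j \<noteq> \<bottom>"
    and irr: "\<And>p q. p \<in> carrier L \<Longrightarrow> q \<in> carrier L \<Longrightarrow> j = p \<squnion> q \<Longrightarrow> p = j \<or> q = j"
    using j by (auto simp: join_irreducible_def)
  define U where "U = {u \<in> carrier L. u \<sqsubset> j}"
  have "\<bottom> \<in> U"
    using finite_bottom_least[OF fin] jc \<open>j \<noteq> \<bottom>\<close> by (auto simp: U_def least_def lless_eq)
  then obtain u where uU: "u \<in> U" and umax: "\<And>v. v \<in> U \<Longrightarrow> u \<sqsubseteq> v \<Longrightarrow> v = u"
    using finite_ex_maximal[of U] fin unfolding U_def by auto
  have u: "u \<in> carrier L" "u \<sqsubseteq> j" "u \<noteq> j"
    using uU by (auto simp: U_def lless_eq)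
  \<comment> \<open>Irreducibility keeps \<open>u \<squnion> v\<close> different from
    \<open>j\<close>, so maximality of \<open>u\<close> absorbs \<open>v\<close>: the maximal
    element of \<open>U\<close> is the greatest.\<close>
  have below: "v \<sqsubseteq> u" if v: "v \<in> carrier L" "v \<sqsubseteq> j" "v \<noteq> j" for v
  proof -
    have "u \<squnion> v \<sqsubseteq> j"
      using u v jc join_le by blast
    moreover have "u \<squnion> v \<noteq> j"
      using irr u v by metis
    ultimately have "u \<squnion> v \<in> U"
      using u v by (auto simp: U_def lless_eq)
    then have "u \<squnion> v = u"
      using umax join_left u v by blast
    then show ?thesis
      using join_right u v by metis
  qed
  have "\<not> j \<sqsubseteq> u"
    using u jc le_antisym by blast
  then obtain d where "d \<in> D" "d \<sqsubseteq> j" "\<not> d \<sqsubseteq> u"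
    using dense jc u by blast
  with below D show ?thesis
    by blast
qed

text \<open>By separation, the number of join-irreducible elements below an element grows strictly
  along a chain; it takes values from 0 to the total number, which accounts for the
  \<open>+ 1\<close>.\<close>

lemma card_chain_le_join_irreducible:
  assumes fin: "finite (carrier L)" and C: "C \<subseteq> carrier L"
    and chain: "Complete_Partial_Order.chain (\<sqsubseteq>) C"
  shows "card C \<le> card {j. join_irreducible L j} + 1"
proof -
  let ?J = "{j. join_irreducible L j}"
  define f where "f c = card {j \<in> ?J. j \<sqsubseteq> c}" for c
  have finJ: "finite ?J"
    by (rule finite_subset[OF _ fin]) (auto simp: join_irreducible_def)
  have less: "f c < f d" if c: "c \<in> C" and d: "d \<in> C" and cd: "c \<sqsubseteq> d" "c \<noteq> d" for c d
  proof -
    have cc: "c \<in> carrier L" "d \<in> carrier L"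
      using C c d by auto
    then have "\<not> d \<sqsubseteq> c"
      using cd le_antisym by blast
    then obtain j where "join_irreducible L j" "j \<sqsubseteq> d" "\<not> j \<sqsubseteq> c"
      using ex_join_irreducible_separating fin cc by blast
    moreover have "{j \<in> ?J. j \<sqsubseteq> c} \<subseteq> {j \<in> ?J. j \<sqsubseteq> d}"
      using cc cd le_trans by (auto simp: join_irreducible_def)
    ultimately show ?thesis
      unfolding f_def using finJ by (intro psubset_card_mono) auto
  qed
  have "inj_on f C"
  proof (rule inj_onI, rule ccontr)
    fix c d assume *: "c \<in> C" "d \<in> C" "f c = f d" "c \<noteq> d"
    then have "c \<sqsubseteq> d \<or> d \<sqsubseteq> c"
      using chain by (auto simp: chain_def)
    with * less show False
      by (metis less_irrefl)
  qed
  moreover have "f ` C \<subseteq> {..card ?J}"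
    unfolding f_def using finJ by (auto intro!: card_mono)
  ultimately have "card C \<le> card {..card ?J}"
    by (intro card_inj_on_le) auto
  then show ?thesis
    by simp
qed

lemma card_join_irreducible:
  assumes fin: "finite (carrier L)" and D: "D \<subseteq> carrier L"
    and dense: "\<And>x y. x \<in> carrier L \<Longrightarrow> y \<in> carrier L \<Longrightarrow> \<not> x \<sqsubseteq> y \<Longrightarrow> \<exists>d\<in>D. d \<sqsubseteq> x \<and> \<not> d \<sqsubseteq> y"
    and cardD: "card D \<le> k"
    and C: "C \<subseteq> carrier L" "Complete_Partial_Order.chain (\<sqsubseteq>) C" "card C = k + 1"
  shows "card {j. join_irreducible L j} = k"
proof (rule antisym)
  have "{j. join_irreducible L j} \<subseteq> D"
    using join_irreducible_mem_join_dense[OF fin D dense] by blast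
  then have "card {j. join_irreducible L j} \<le> card D"
    using D fin by (intro card_mono) (auto intro: finite_subset)
  with cardD show "card {j. join_irreducible L j} \<le> k"
    by simp
  show "k \<le> card {j. join_irreducible L j}"
    using card_chain_le_join_irreducible[OF fin C(1,2)] C(3) by simp
qed

section \<open>Dualization and the criterion\<close>

lemma join_irreducible_dual:
  "join_irreducible (inv_gorder L) = meet_irreducible L"
  by (simp add: fun_eq_iff join_irreducible_def meet_irreducible_def)

lemma extremalI:
  assumes fin: "finite (carrier L)"
    and D: "D \<subseteq> carrier L" "card D \<le> k"
      "\<And>x y. x \<in> carrier L \<Longrightarrow> y \<in> carrier L \<Longrightarrow> \<not> x \<sqsubseteq> y \<Longrightarrow> \<exists>d\<in>D. d \<sqsubseteq> x \<and> \<not> d \<sqsubseteq> y"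
    and E: "E \<subseteq> carrier L" "card E \<le> k"
      "\<And>x y. x \<in> carrier L \<Longrightarrow> y \<in> carrier L \<Longrightarrow> \<not> x \<sqsubseteq> y \<Longrightarrow> \<exists>e\<in>E. y \<sqsubseteq> e \<and> \<not> x \<sqsubseteq> e"
    and C: "C \<subseteq> carrier L" "Complete_Partial_Order.chain (\<sqsubseteq>) C" "card C = k + 1"
  shows "extremal L"
proof -
  have J: "card {j. join_irreducible L j} = k"
    using card_join_irreducible[OF fin D(1,3,2) C] by blast
  \<comment> \<open>In the dual order the meet-dense set \<open>E\<close> becomes join-dense, and
    \<open>C\<close> is still a chain.\<close>
  have "card {j. join_irreducible (inv_gorder L) j} = k"
  proof (rule lattice.card_join_irreducible[OF dual_lattice, where D = E and C = C])
    show "Complete_Partial_Order.chain (\<sqsubseteq>\<^bsub>inv_gorder L\<^esub>) C"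
      using C(2) by (auto simp: chain_def)
  qed (use fin E C in auto)
  then have M: "card {j. meet_irreducible L j} = k"
    by (simp add: join_irreducible_dual)
  let ?S = "{card C |C. C \<subseteq> carrier L \<and> Complete_Partial_Order.chain (\<sqsubseteq>) C}"
  \<comment> \<open>The bound makes the set of chain sizes finite, so that \<open>Max\<close> is
    meaningful; \<open>C\<close> attains it.\<close>
  have bound: "x \<le> k + 1" if "x \<in> ?S" for x
    using that card_chain_le_join_irreducible[OF fin] J by auto
  then have "finite ?S"
    by (intro finite_subset[of ?S "{..k + 1}"]) auto
  moreover have "k + 1 \<in> ?S"
    using C by (intro CollectI exI[of _ C]) simp
  ultimately have "Max ?S = k + 1"
    using bound by (intro Max_eqI) auto
  then have "lattice_length L = k"
    by (simp add: lattice_length_def)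
  moreover have "carrier L \<noteq> {}"
    using C by auto
  ultimately show ?thesis
    using fin J M lattice_axioms by (auto simp: extremal_def)
qed

end

section \<open>Words\<close>

definition letter_max :: "nat \<Rightarrow> nat \<Rightarrow> nat" where
  "letter_max m i = (if i = 0 then m else m + 1)"

lemma letter_max_le: "letter_max m i \<le> m + 1"
  by (auto simp: letter_max_def)

text \<open>Alphabet and (MN1) merge into one bound per place. (MN2) extends to the letter 0, where
  it is trivial, so only the condition \<open>w ! i \<le> m\<close> remains.\<close>

lemma mn_word_iff:
  "mn_word m n w \<longleftrightarrow> length w = n \<and> (\<forall>i<n. w ! i \<le> letter_max m i) \<and>
     (\<forall>i<n. w ! i \<le> m \<longrightarrow> (\<forall>j<i. w ! i \<le> w ! j))"
proof -
  have "set w \<subseteq> {0..m + 1} \<and> (0 < n \<longrightarrow> w ! 0 \<noteq> m + 1) \<longleftrightarrow> (\<forall>i<n. w ! i \<le> letter_max m i)"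
    if "length w = n"
    using that by (force simp: letter_max_def set_conv_nth subset_iff)
  moreover have "(\<forall>s i. 1 \<le> s \<and> s \<le> m \<and> i < n \<and> w ! i = s \<longrightarrow> (\<forall>j<i. s \<le> w ! j)) \<longleftrightarrow>
      (\<forall>i<n. w ! i \<le> m \<longrightarrow> (\<forall>j<i. w ! i \<le> w ! j))"
    by (metis less_one not_le zero_le)
  ultimately show ?thesis
    unfolding mn_word_def by blast
qed

lemma mn_word_map:
  assumes "\<And>i. i < n \<Longrightarrow> f i \<le> letter_max m i"
    and "\<And>i j. j < i \<Longrightarrow> i < n \<Longrightarrow> f i \<le> m \<Longrightarrow> f i \<le> f j"
  shows "mn_word m n (map f [0..<n])"
  using assms by (auto simp: mn_word_iff)

section \<open>Order and lattice operations on words\<close>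

lemma carrier_mn_words: "carrier (mn_words m n) = {w. mn_word m n w}"
  and eq_mn_words: "eq (mn_words m n) = (=)"
  and le_mn_words: "le (mn_words m n) = list_all2 (\<le>)"
  by (simp_all add: mn_words_def)

lemma le_mn_words_iff:
  assumes "mn_word m n u" and "mn_word m n v"
  shows "u \<sqsubseteq>\<^bsub>mn_words m n\<^esub> v \<longleftrightarrow> (\<forall>i<n. u ! i \<le> v ! i)"
  using assms by (auto simp: le_mn_words mn_word_iff list_all2_conv_all_nth)

lemma finite_mn_words: "finite (carrier (mn_words m n))"
proof (rule finite_subset)
  show "carrier (mn_words m n) \<subseteq> {w. set w \<subseteq> {0..m + 1} \<and> length w = n}"
    by (auto simp: carrier_mn_words mn_word_def)
qed (simp add: finite_lists_length_eq)

lemma partial_order_mn_words: "partial_order (mn_words m n)"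
proof unfold_locales
  show "x \<sqsubseteq>\<^bsub>mn_words m n\<^esub> z"
    if "x \<sqsubseteq>\<^bsub>mn_words m n\<^esub> y" "y \<sqsubseteq>\<^bsub>mn_words m n\<^esub> z" for x y z
    using that list_all2_trans[of "(\<le>)" "(\<le>)" "(\<le>)" x y z] by (auto simp: le_mn_words)
  show "x .=\<^bsub>mn_words m n\<^esub> y"
    if "x \<sqsubseteq>\<^bsub>mn_words m n\<^esub> y" "y \<sqsubseteq>\<^bsub>mn_words m n\<^esub> x" for x y
    using that list_all2_antisym[of "(\<le>)" "(\<le>)" x y] by (auto simp: le_mn_words eq_mn_words)
qed (auto simp: eq_mn_words le_mn_words intro: list_all2_refl)

text \<open>The componentwise maximum is a word: if it is at most \<open>m\<close> at some place, so
  are both letters there, and each is bounded by the earlier letters of its own word.\<close>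

lemma mn_words_sup_exists:
  assumes u: "mn_word m n u" and v: "mn_word m n v"
  shows "\<exists>s. least (mn_words m n) s (Upper (mn_words m n) {u, v})"
proof -
  define s where "s = map (\<lambda>i. max (u ! i) (v ! i)) [0..<n]"
  have s: "mn_word m n s"
    unfolding s_def
    by (rule mn_word_map) (use u v in \<open>auto simp: mn_word_iff max_def\<close>, (meson le_trans nat_le_linear)+)
  have "least (mn_words m n) s (Upper (mn_words m n) {u, v})"
    using s u v
    by (auto simp: least_def Upper_def carrier_mn_words le_mn_words_iff) (auto simp: s_def)
  then show ?thesis ..
qed

text \<open>The componentwise minimum need not be a word: \<open>02\<close> and \<open>11\<close> have minimum \<open>01\<close>. Letters
  other than \<open>m + 1\<close> are therefore lowered to the minimum over the prefix.\<close>

lemma mn_words_inf_exists: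
  assumes u: "mn_word m n u" and v: "mn_word m n v"
  shows "\<exists>s. greatest (mn_words m n) s (Lower (mn_words m n) {u, v})"
proof -
  define h where "h i = min (u ! i) (v ! i)" for i
  define f where "f i = (if h i = m + 1 then m + 1 else Min (h ` {..i}))" for i
  define s where "s = map f [0..<n]"
  have h: "h i \<le> letter_max m i" if "i < n" for i
    using u that by (auto simp: h_def mn_word_iff min.coboundedI1)
  have Min_le_h: "Min (h ` {..i}) \<le> h j" if "j \<le> i" for i j
    using that by (intro Min_le) auto
  have f_le: "f i \<le> h i" for i
    using Min_le_h[of i i] by (auto simp: f_def)
  have s: "mn_word m n s"
    unfolding s_def
  proof (rule mn_word_map)
    fix i assume "i < n"
    then show "f i \<le> letter_max m i"
      using f_le h le_trans by blast
  next
    fix i j assume ij: "j < i" "i < n" "f i \<le> m"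
    \<comment> \<open>Since \<open>f i \<le> m\<close>, \<open>f i\<close> is a prefix minimum;
      \<open>f j\<close> is either the minimum over a shorter prefix or
      \<open>m + 1\<close>.\<close>
    have "Min (h ` {..i}) \<le> Min (h ` {..j})"
      using ij by (intro Min_antimono) auto
    then show "f i \<le> f j"
      using ij by (auto simp: f_def split: if_splits)
  qed
  have "y ! i \<le> f i" if y: "mn_word m n y" "\<forall>i<n. y ! i \<le> u ! i" "\<forall>i<n. y ! i \<le> v ! i" and i: "i < n" for y i
  proof (cases "h i = m + 1")
    case True
    then show ?thesis
      using y(1) i letter_max_le[of m i] by (auto simp: f_def mn_word_iff intro: le_trans)
  next
    case False
    have yh: "y ! j \<le> h j" if "j < n" for j
      using y that by (simp add: h_def)
    \<comment> \<open>This makes (MN2) applicable to \<open>y\<close>: the letter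
      \<open>y ! i\<close> bounds the whole prefix of \<open>y\<close> from below, hence also that
      of \<open>h\<close>.\<close>
    have "y ! i \<le> m"
      using False yh[OF i] h[OF i] letter_max_le[of m i] by linarith
    then have "y ! i \<le> y ! j" if "j \<le> i" for j
      using y(1) i that by (cases "j = i") (auto simp: mn_word_iff)
    then have "y ! i \<le> h j" if "j \<le> i" for j
      using yh[of j] i that by (meson le_trans le_less_trans)
    then show ?thesis
      using False by (auto simp: f_def)
  qed
  then have "greatest (mn_words m n) s (Lower (mn_words m n) {u, v})"
    using s u v f_le
    by (auto simp: greatest_def Lower_def carrier_mn_words le_mn_words_iff) (auto simp: s_def h_def)
  then show ?thesis ..
qed

lemma lattice_mn_words: "Lattice.lattice (mn_words m n)"
proof -
  interpret partial_order "mn_words m n"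
    by (rule partial_order_mn_words)
  show ?thesis
    by unfold_locales (simp_all add: carrier_mn_words mn_words_sup_exists mn_words_inf_exists)
qed

section \<open>Join-dense and meet-dense families of words\<close>

text \<open>A common index set for both dense families and the chain; its cardinality is the sum of
  the letter maxima.\<close>

definition word_cells :: "nat \<Rightarrow> nat \<Rightarrow> (nat \<times> nat) set" where
  "word_cells m n = (SIGMA i:{..<n}. {1..letter_max m i})"

lemma finite_word_cells: "finite (word_cells m n)"
  by (simp add: word_cells_def)

lemma mem_word_cells: "(i, s) \<in> word_cells m n \<longleftrightarrow> i < n \<and> 1 \<le> s \<and> s \<le> letter_max m i"
  by (auto simp: word_cells_def)

text \<open>By (MN2), a letter \<open>s \<le> m\<close> at place \<open>i\<close> forces letters of
  at least \<open>s\<close> at all earlier places, whereas \<open>m + 1\<close> forces nothing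
  there.\<close>

definition least_word :: "nat \<Rightarrow> nat \<Rightarrow> nat \<times> nat \<Rightarrow> nat list" where
  "least_word m n = (\<lambda>(i, s). map (\<lambda>j. if j = i \<or> j < i \<and> s \<le> m then s else 0) [0..<n])"

lemma mn_word_least_word:
  assumes "c \<in> word_cells m n"
  shows "mn_word m n (least_word m n c)"
proof -
  obtain i s where c: "c = (i, s)" "i < n" "1 \<le> s" "s \<le> letter_max m i"
    using assms by (cases c) (auto simp: mem_word_cells)
  show ?thesis
    unfolding c(1) least_word_def prod.case
    by (rule mn_word_map) (use c in \<open>auto simp: letter_max_def split: if_splits\<close>)
qed

text \<open>At a place where \<open>x\<close> exceeds \<open>y\<close>, the least word with the
  letter of \<open>x\<close> there stays below \<open>x\<close> but not below
  \<open>y\<close>.\<close>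

lemma least_word_separates:
  assumes x: "mn_word m n x" and y: "mn_word m n y" and "\<not> x \<sqsubseteq>\<^bsub>mn_words m n\<^esub> y"
  shows "\<exists>c\<in>word_cells m n. least_word m n c \<sqsubseteq>\<^bsub>mn_words m n\<^esub> x \<and> \<not> least_word m n c \<sqsubseteq>\<^bsub>mn_words m n\<^esub> y"
proof -
  obtain i where i: "i < n" "y ! i < x ! i"
    using assms by (auto simp: le_mn_words_iff not_le)
  then have c: "(i, x ! i) \<in> word_cells m n"
    using x by (auto simp: mem_word_cells mn_word_iff)
  moreover have "least_word m n (i, x ! i) \<sqsubseteq>\<^bsub>mn_words m n\<^esub> x"
    using mn_word_least_word[OF c] x i by (simp add: le_mn_words_iff) (auto simp: least_word_def mn_word_iff)
  moreover have "\<not> least_word m n (i, x ! i) \<sqsubseteq>\<^bsub>mn_words m n\<^esub> y"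
    using mn_word_least_word[OF c] y i by (auto simp: le_mn_words_iff least_word_def intro!: exI[of _ i])
  ultimately show ?thesis
    by blast
qed

text \<open>The shift to \<open>s - 1\<close> lets the same cells index the nonmaximal letters.
  (MN2) holds because the earlier letters are at least \<open>m\<close> and the later ones equal
  \<open>m + 1\<close>.\<close>

definition greatest_word :: "nat \<Rightarrow> nat \<Rightarrow> nat \<times> nat \<Rightarrow> nat list" where
  "greatest_word m n = (\<lambda>(i, s). map (\<lambda>j. if j = i then s - 1 else letter_max m j) [0..<n])"

lemma mn_word_greatest_word:
  assumes "c \<in> word_cells m n"
  shows "mn_word m n (greatest_word m n c)"
proof -
  obtain i s where c: "c = (i, s)" "i < n" "1 \<le> s" "s \<le> letter_max m i"
    using assms by (cases c) (auto simp: mem_word_cells)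
  show ?thesis
    unfolding c(1) greatest_word_def prod.case
    by (rule mn_word_map) (use c in \<open>auto simp: letter_max_def split: if_splits\<close>)
qed

lemma greatest_word_separates:
  assumes x: "mn_word m n x" and y: "mn_word m n y" and "\<not> x \<sqsubseteq>\<^bsub>mn_words m n\<^esub> y"
  shows "\<exists>c\<in>word_cells m n. y \<sqsubseteq>\<^bsub>mn_words m n\<^esub> greatest_word m n c \<and> \<not> x \<sqsubseteq>\<^bsub>mn_words m n\<^esub> greatest_word m n c"
proof -
  obtain i where i: "i < n" "y ! i < x ! i"
    using assms by (auto simp: le_mn_words_iff not_le)
  moreover have "x ! i \<le> letter_max m i"
    using x i by (simp add: mn_word_iff)
  ultimately have c: "(i, y ! i + 1) \<in> word_cells m n"
    by (auto simp: mem_word_cells)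
  moreover have "y \<sqsubseteq>\<^bsub>mn_words m n\<^esub> greatest_word m n (i, y ! i + 1)"
    using mn_word_greatest_word[OF c] y i
    by (simp add: le_mn_words_iff) (auto simp: greatest_word_def mn_word_iff)
  moreover have "\<not> x \<sqsubseteq>\<^bsub>mn_words m n\<^esub> greatest_word m n (i, y ! i + 1)"
    using mn_word_greatest_word[OF c] x i
    by (auto simp: le_mn_words_iff greatest_word_def not_le intro!: exI[of _ i])
  ultimately show ?thesis
    by blast
qed

section \<open>A longest chain of words\<close>

text \<open>The word reached once the letter with index \<open>i\<close> has been raised to \<open>s\<close> in round \<open>s\<close>.\<close>

definition step_word :: "nat \<Rightarrow> nat \<Rightarrow> nat \<times> nat \<Rightarrow> nat list" where
  "step_word m n = (\<lambda>(i, s). map (\<lambda>j. min (letter_max m j) (if j \<le> i then s else s - 1)) [0..<n])"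

text \<open>Without the cap the letters decrease weakly from left to right. The cap is at least
  \<open>m\<close>, so it cannot push a letter below a later one that is at most
  \<open>m\<close>.\<close>

lemma mn_word_step_word: "mn_word m n (step_word m n c)"
  unfolding step_word_def
  by (cases c, simp only: prod.case, rule mn_word_map) (auto simp: letter_max_def)

lemma step_word_less:
  assumes c: "(i, s) \<in> word_cells m n" and c': "(i', s') \<in> word_cells m n"
    and less: "s < s' \<or> s = s' \<and> i < i'"
  shows "step_word m n (i, s) \<sqsubseteq>\<^bsub>mn_words m n\<^esub> step_word m n (i', s')"
    and "step_word m n (i, s) \<noteq> step_word m n (i', s')"
proof -
  show "step_word m n (i, s) \<sqsubseteq>\<^bsub>mn_words m n\<^esub> step_word m n (i', s')"
    using less by (subst le_mn_words_iff[OF mn_word_step_word mn_word_step_word])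
      (auto simp: step_word_def intro!: min.mono)
  \<comment> \<open>The later step has just raised the letter at \<open>i'\<close> to
    \<open>s'\<close>, which the cap permits as \<open>(i', s')\<close> is a cell; before that the
    letter was at most \<open>s' - 1\<close>.\<close>
  have "step_word m n (i, s) ! i' < step_word m n (i', s') ! i'"
    using c c' less by (auto simp: step_word_def mem_word_cells)
  then show "step_word m n (i, s) \<noteq> step_word m n (i', s')"
    by auto
qed

lemma inj_on_step_word: "inj_on (step_word m n) (word_cells m n)"
proof (rule inj_onI)
  fix c c' assume *: "c \<in> word_cells m n" "c' \<in> word_cells m n" "step_word m n c = step_word m n c'"
  obtain i s i' s' where "c = (i, s)" "c' = (i', s')"
    by (cases c, cases c')
  then show "c = c'"
    using * step_word_less(2)[of i s m n i' s'] step_word_less(2)[of i' s' m n i s]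
    by (metis linorder_neqE_nat)
qed

lemma chain_step_word: "Complete_Partial_Order.chain (\<sqsubseteq>\<^bsub>mn_words m n\<^esub>) (step_word m n ` word_cells m n)"
proof (rule chainI)
  fix u v assume "u \<in> step_word m n ` word_cells m n" "v \<in> step_word m n ` word_cells m n"
  then obtain i s i' s' where uv: "u = step_word m n (i, s)" "v = step_word m n (i', s')"
    and c: "(i, s) \<in> word_cells m n" "(i', s') \<in> word_cells m n"
    by auto
  consider "s < s' \<or> s = s' \<and> i < i'" | "s' < s \<or> s' = s \<and> i' < i" | "i = i'" "s = s'"
    by linarith
  then show "u \<sqsubseteq>\<^bsub>mn_words m n\<^esub> v \<or> v \<sqsubseteq>\<^bsub>mn_words m n\<^esub> u"
  proof cases
    case 3
    then show ?thesis
      using uv by (simp add: le_mn_words list_all2_refl)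
  qed (use uv c step_word_less(1) in blast)+
qed

theorem theorem4p7:
  fixes m n :: nat
  shows "extremal (mn_words m n)"
proof -
  let ?L = "mn_words m n" and ?I = "word_cells m n"
  interpret Lattice.lattice ?L
    by (rule lattice_mn_words)
  define bot where "bot = replicate n (0 :: nat)"
  \<comment> \<open>Each step word of a cell \<open>(i, s)\<close> is nonzero at \<open>i\<close>
    because \<open>s \<ge> 1\<close>, so the zero word is the extra element that brings the chain to
    \<open>k + 1\<close>.\<close>
  define C where "C = insert bot (step_word m n ` ?I)"
  have bot: "mn_word m n bot"
    by (auto simp: mn_word_iff bot_def)
  then have bot_le: "bot \<sqsubseteq>\<^bsub>?L\<^esub> w" if "mn_word m n w" for w
    using that by (simp add: le_mn_words_iff) (simp add: bot_def)
  have "step_word m n c \<noteq> bot" if "c \<in> ?I" for c :: "nat \<times> nat"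
  proof -
    obtain i s where c: "c = (i, s)" "i < n" "1 \<le> s" "s \<le> letter_max m i"
      using \<open>c \<in> ?I\<close> by (cases c) (auto simp: mem_word_cells)
    then have "step_word m n c ! i \<noteq> bot ! i"
      by (simp add: step_word_def bot_def)
    then show ?thesis
      by auto
  qed
  then have "bot \<notin> step_word m n ` ?I"
    by auto
  then have cardC: "card C = card ?I + 1"
    by (simp add: C_def finite_word_cells card_image[OF inj_on_step_word])
  \<comment> \<open>Here \<open>k\<close> is the number of cells. The dense families are images of
    the cells, which bounds their sizes by \<open>k\<close>.\<close>
  show ?thesis
  proof (rule extremalI[where D = "least_word m n ` ?I" and E = "greatest_word m n ` ?I" and C = C])
    show "C \<subseteq> carrier ?L"
      using bot mn_word_step_word by (auto simp: C_def carrier_mn_words)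
    show "Complete_Partial_Order.chain (\<sqsubseteq>\<^bsub>?L\<^esub>) C"
      using chain_step_word[of m n] bot_le bot mn_word_step_word
      unfolding C_def chain_def by blast
  qed (use finite_mn_words cardC mn_word_least_word mn_word_greatest_word
        least_word_separates greatest_word_separates finite_word_cells
      in \<open>auto simp: carrier_mn_words card_image_le\<close>)
qed

end
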